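(* Let $f\in\mathcal{S}(L,m)$ with unique minimizer $x^\star$, and suppose that $\kappa=L/m\ge 2$. Let $y_t$ be the iterates generated by the NAG-free algorithm (described in the context) for given input parameters $L_0\ge m$, $1<\gamma\le 2$ and $1<\gamma_L\le 2$, from the initial point $x_0=y_0\in\mathbb{R}^d$. Let $\bar\kappa=\max(L_0,2L)/m$. Then, for all $t\ge 0$, $$f(y_{t+1})-f(x^\star)\le\Bigl(1-\frac1{\bar\kappa}\Bigr)^{t}\,8\max(L_0,L)\,\bar\kappa^{3}\,\Vert x_0-x^\star\Vert^2 .$$
   Context: $\Vert\cdot\Vert$ is the Euclidean norm. A differentiable $f:\mathbb{R}^d\to\mathbb{R}$ belongs to $\mathcal{S}(L,m)$, with $L>0$ and $m>0$, if for all $x,y\in\mathbb{R}^d$ $$f(x)+\langle\nabla f(x),y-x\rangle+\tfrac m2\Vert y-x\Vert^2\le f(y)\le f(x)+\langle\nabla f(x),y-x\rangle+\tfrac L2\Vert y-x\Vert^2 .$$ NAG-free algorithm. Inputs: $x_0=y_0\in\mathbb{R}^d$, $L_0>0$, $\gamma>1$, $\gamma_L>1$. Set $m_0=L_0$. For $t=0,1,2,\dots$: (1) Backtracking: starting from the current value $L_t$, set $y_{t+1}=x_t-(1/L_t)\nabla f(x_t)$; while $f(y_{t+1})>f(x_t)-\frac1{2L_t}\Vert\nabla f(x_t)\Vert^2$, replace $L_t$ by $\gamma_L L_t$ and recompute $y_{t+1}=x_t-(1/L_t)\nabla f(x_t)$. Let $\hat L_t$ be the final value of $L_t$ in this iteration,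 so $y_{t+1}=x_t-(1/\hat L_t)\nabla f(x_t)$, and set $L_{t+1}=\hat L_t$ (the starting value for the next iteration). (2) Set $x_{t+1}=y_{t+1}+\dfrac{\sqrt{\hat L_t}-\sqrt{m_t}}{\sqrt{\hat L_t}+\sqrt{m_t}}\,(y_{t+1}-y_t)$. (3) Set $c_{t+1}=\Vert\nabla f(x_{t+1})-\nabla f(x_t)\Vert/\Vert x_{t+1}-x_t\Vert$ (defined for $x_{t+1}\ne x_t$). (4) If $c_{t+1}<m_t$, set $m_{t+1}=\min(m_t/\gamma,c_{t+1})$; otherwise set $m_{t+1}=m_t$. In the theorem, $L_0$ is the input value. The iterates are considered as long as they are well defined, i.e. $x_{t+1}\neq x_t$ whenever $c_{t+1}$ is computed. *)

theory Defs
  imports "HOL-Analysis.Analysis" "HOL-Library.While_Combinator"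
begin

definition grad :: "('a::euclidean_space \<Rightarrow> real) \<Rightarrow> 'a \<Rightarrow> 'a" where
  "grad f x = (THE g. GDERIV f x :> g)"

definition smooth_strongly_convex :: "real \<Rightarrow> real \<Rightarrow> ('a::euclidean_space \<Rightarrow> real) set" where
  "smooth_strongly_convex L m =
    {f. L > 0 \<and> m > 0 \<and> (\<forall>x. f differentiable (at x)) \<and>
        (\<forall>x y. f x + grad f x \<bullet> (y - x) + m / 2 * (norm (y - x))\<^sup>2 \<le> f y \<and>
               f y \<le> f x + grad f x \<bullet> (y - x) + L / 2 * (norm (y - x))\<^sup>2)}"

text \<open>The state at the start of iteration \<open>t\<close>: the iterates \<open>x\<^sub>t\<close> and \<open>y\<^sub>t\<close>, the value of
  \<open>L\<^sub>t\<close> from which backtracking starts, and the estimate \<open>m\<^sub>t\<close>.\<close>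

datatype 'a nag_state = Nag_State (nag_x: 'a) (nag_y: 'a) (nag_L: real) (nag_m: real)

definition gd_step :: "('a::euclidean_space \<Rightarrow> real) \<Rightarrow> real \<Rightarrow> 'a \<Rightarrow> 'a" where
  "gd_step f L x = x - (1 / L) *\<^sub>R grad f x"

text \<open>For \<open>f\<close> in \<open>smooth_strongly_convex L m\<close>, \<open>\<gamma>L > 1\<close> and a positive starting value the loop
  terminates: its guard is false once the current value reaches \<open>L\<close>.\<close>

definition backtrack :: "('a::euclidean_space \<Rightarrow> real) \<Rightarrow> real \<Rightarrow> 'a \<Rightarrow> real \<Rightarrow> real" where
  "backtrack f \<gamma>L x =
    while (\<lambda>L. f (gd_step f L x) > f x - 1 / (2 * L) * (norm (grad f x))\<^sup>2) (\<lambda>L. \<gamma>L * L)"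

text \<open>The quotient \<open>c\<close> is meaningful only if \<open>x' \<noteq> x\<close>; if \<open>x' = x\<close>, it is \<open>0\<close> by the convention
  for division and the resulting state is not one the algorithm produces. Statements about the
  iterates have to exclude this case.\<close>

fun nag_step :: "('a::euclidean_space \<Rightarrow> real) \<Rightarrow> real \<Rightarrow> real \<Rightarrow> 'a nag_state \<Rightarrow> 'a nag_state" where
  "nag_step f \<gamma> \<gamma>L (Nag_State x y L m) =
    (let L' = backtrack f \<gamma>L x L;
         y' = gd_step f L' x;
         x' = y' + ((sqrt L' - sqrt m) / (sqrt L' + sqrt m)) *\<^sub>R (y' - y);
         c = norm (grad f x' - grad f x) / norm (x' - x);
         m' = (if c < m then min (m / \<gamma>) c else m)
     in Nag_State x' y' L' m')"

definition nag_free ::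
  "('a::euclidean_space \<Rightarrow> real) \<Rightarrow> real \<Rightarrow> real \<Rightarrow> real \<Rightarrow> 'a \<Rightarrow> nat \<Rightarrow> 'a nag_state" where
  "nag_free f L0 \<gamma> \<gamma>L x0 t = (nag_step f \<gamma> \<gamma>L ^^ t) (Nag_State x0 x0 L0 L0)"

end

theory Submission imports Defs begin

text \<open>With \<open>\<rho> = 1 / \<kappa>bar\<close> and \<open>x\<^sub>t = y\<^sub>t + \<theta> d\<close>, where \<open>d = y\<^sub>t - y\<^sub>t\<^sub>-\<^sub>1\<close>, the energy
  \<open>(f y\<^sub>t - f x\<^sup>\<star>) / L\<^sub>t + \<parallel>\<rho> (y\<^sub>t - x\<^sup>\<star>) + (1 - \<rho>) d\<parallel>\<^sup>2 / 2\<close> contracts by the factor \<open>1 - \<rho>\<close> whatever the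
  momentum \<open>\<theta> \<in> [0, 1 - \<rho>]\<close> is, so the estimates \<open>m\<^sub>t\<close> enter only through the bound
  \<open>\<theta> \<le> 1 - \<rho>\<close>, for which \<open>m\<^sub>t \<ge> m / 2\<close> suffices. The increase of \<open>L\<^sub>t\<close> by backtracking only
  lowers the energy, and the final bound \<open>L\<^sub>t \<le> \<kappa>bar m\<close> turns the energy back into a bound on \<open>f\<close>.\<close>

section \<open>Quadratic bounds and the gradient step\<close>

lemma smooth_strongly_convexD:
  assumes "f \<in> smooth_strongly_convex L m"
  shows "L > 0" "m > 0"
    and "f x + grad f x \<bullet> (y - x) + m / 2 * (norm (y - x))\<^sup>2 \<le> f y"
    and "f y \<le> f x + grad f x \<bullet> (y - x) + L / 2 * (norm (y - x))\<^sup>2"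
  using assms unfolding smooth_strongly_convex_def by auto

lemma gd_step_decrease:
  assumes f: "f \<in> smooth_strongly_convex L m" and "L \<le> l"
  shows "f (gd_step f l x) \<le> f x - 1 / (2 * l) * (norm (grad f x))\<^sup>2"
proof -
  let ?g = "grad f x"
  have "l > 0" using smooth_strongly_convexD(1)[OF f] \<open>L \<le> l\<close> by simp
  have "f (gd_step f l x) \<le> f x - 1 / l * (norm ?g)\<^sup>2 + L / 2 * ((norm ?g)\<^sup>2 / l\<^sup>2)"
    using smooth_strongly_convexD(4)[OF f, where x = x and y = "gd_step f l x"] \<open>l > 0\<close>
    by (simp add: gd_step_def power_divide power2_norm_eq_inner)
  also have "\<dots> \<le> f x - 1 / l * (norm ?g)\<^sup>2 + l / 2 * ((norm ?g)\<^sup>2 / l\<^sup>2)"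
    using \<open>L \<le> l\<close> by (intro add_left_mono mult_right_mono) auto
  also have "\<dots> = f x - 1 / (2 * l) * (norm ?g)\<^sup>2"
    using \<open>l > 0\<close> by (simp add: field_simps power2_eq_square)
  finally show ?thesis .
qed

text \<open>A gradient step of length \<open>1 / L\<close> from the minimizer cannot lower
  \<open>f\<close>, yet the descent inequality forces a drop proportional to the squared gradient
  norm.\<close>

lemma grad_minimizer_eq_0:
  assumes f: "f \<in> smooth_strongly_convex L m" and min: "is_arg_min f (\<lambda>_. True) xstar"
  shows "grad f xstar = 0"
proof -
  have "f xstar \<le> f (gd_step f L xstar)"
    using min by (simp add: is_arg_min_linorder)
  also have "\<dots> \<le> f xstar - 1 / (2 * L) * (norm (grad f xstar))\<^sup>2"
    by (rule gd_step_decrease[OF f order_refl])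
  finally have "(norm (grad f xstar))\<^sup>2 \<le> 0"
    using smooth_strongly_convexD(1)[OF f] by (simp add: divide_le_0_iff)
  then show ?thesis by simp
qed

text \<open>Adding the two lower quadratic bounds gives strong monotonicity of the gradient;
  Cauchy-Schwarz does the rest. It makes every quotient \<open>c\<close> of the algorithm at least
  \<open>m\<close>.\<close>

lemma norm_grad_diff_ge:
  assumes f: "f \<in> smooth_strongly_convex L m"
  shows "m * norm (z - x) \<le> norm (grad f z - grad f x)"
proof (cases "z = x")
  case False
  have "m * (norm (z - x))\<^sup>2 \<le> (grad f z - grad f x) \<bullet> (z - x)"
    using smooth_strongly_convexD(3)[OF f, where x = x and y = z]
      smooth_strongly_convexD(3)[OF f, where x = z and y = x]
    by (simp add: norm_minus_commute inner_diff_left inner_diff_right)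
  also have "\<dots> \<le> norm (grad f z - grad f x) * norm (z - x)"
    by (rule norm_cauchy_schwarz)
  finally show ?thesis
    using False by (simp add: power2_eq_square)
qed simp

section \<open>Backtracking\<close>

text \<open>The guard holds only below \<open>L\<close>, so each multiplication starts below
  \<open>L\<close> and overshoots to at most \<open>\<gamma>L * L\<close>; the maximum covers a
  start that is already large.\<close>

lemma backtrack_bounds:
  fixes x :: "'a::euclidean_space"
  assumes f: "f \<in> smooth_strongly_convex L m" and \<gamma>L: "1 < \<gamma>L" and l: "l > 0"
  defines "l' \<equiv> backtrack f \<gamma>L x l"
  shows "l \<le> l'" and "l' \<le> max l (\<gamma>L * L)"
    and "f (gd_step f l' x) \<le> f x - 1 / (2 * l') * (norm (grad f x))\<^sup>2"
proof -
  let ?P = "\<lambda>k. l \<le> k \<and> k \<le> max l (\<gamma>L * L)"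
  let ?b = "\<lambda>k. f (gd_step f k x) > f x - 1 / (2 * k) * (norm (grad f x))\<^sup>2"
  \<comment> \<open>The least increment of one pass, as the current value never drops below
    \<open>l\<close>. The termination measure counts how many such increments fit below
    \<open>L\<close>.\<close>
  define \<delta> where "\<delta> = (\<gamma>L - 1) * l"
  have \<delta>: "\<delta> > 0" using \<gamma>L l by (simp add: \<delta>_def)
  have guard: "k < L" if "?b k" for k
    using gd_step_decrease[OF f, of k x] that by linarith
  have incr: "\<delta> \<le> \<gamma>L * k - k" if "l \<le> k" for k
    using that \<gamma>L mult_left_mono[of l k "\<gamma>L - 1"] by (simp add: \<delta>_def algebra_simps)
  have "?P l' \<and> \<not> ?b l'"
    unfolding l'_def backtrack_def
  proof (rule while_rule[where P = ?P and r = "Wellfounded.measure (\<lambda>k. nat \<lceil>(L - k) / \<delta>\<rceil>)"])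
    fix k assume k: "?P k" "?b k"
    have "\<gamma>L * k \<le> \<gamma>L * L"
      using guard[OF k(2)] \<gamma>L by simp
    then show "?P (\<gamma>L * k)"
      using incr[of k] k(1) \<delta> by linarith
    have "(L - \<gamma>L * k) / \<delta> \<le> (L - k - \<delta>) / \<delta>"
      using incr[of k] k(1) \<delta> by (intro divide_right_mono) auto
    then have "(L - \<gamma>L * k) / \<delta> \<le> (L - k) / \<delta> - 1"
      using \<delta> by (simp add: diff_divide_distrib)
    \<comment> \<open>Positivity keeps \<open>nat\<close> from truncating both measures to
      0.\<close>
    moreover have "(L - k) / \<delta> > 0"
      using guard[OF k(2)] \<delta> by simp
    ultimately have "nat \<lceil>(L - \<gamma>L * k) / \<delta>\<rceil> < nat \<lceil>(L - k) / \<delta>\<rceil>"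
      by linarith
    then show "(\<gamma>L * k, k) \<in> Wellfounded.measure (\<lambda>k. nat \<lceil>(L - k) / \<delta>\<rceil>)"
      by simp
  qed auto
  then show "l \<le> l'" "l' \<le> max l (\<gamma>L * L)"
    "f (gd_step f l' x) \<le> f x - 1 / (2 * l') * (norm (grad f x))\<^sup>2"
    by auto
qed

section \<open>Momentum and contraction of the energy\<close>

text \<open>After clearing the denominator, the upper bound reads
  \<open>\<rho> * sqrt l + \<rho> * sqrt \<mu> \<le> 2 * sqrt \<mu>\<close>, and each summand on the
  left is at most \<open>sqrt \<mu>\<close>.\<close>

lemma momentum_bounds:
  fixes l \<mu> \<rho> :: real
  assumes "0 < l" "0 \<le> \<mu>" "\<mu> \<le> l" "0 \<le> \<rho>" "\<rho> \<le> 1" "\<rho>\<^sup>2 * l \<le> \<mu>"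
  defines "\<theta> \<equiv> (sqrt l - sqrt \<mu>) / (sqrt l + sqrt \<mu>)"
  shows "0 \<le> \<theta>" and "\<theta> \<le> 1 - \<rho>"
proof -
  have pos: "sqrt l + sqrt \<mu> > 0"
    using assms by (simp add: add_pos_nonneg)
  show "0 \<le> \<theta>"
    using assms pos by simp
  have "\<rho> * sqrt l = sqrt (\<rho>\<^sup>2 * l)"
    using assms by (simp add: real_sqrt_mult)
  also have "\<dots> \<le> sqrt \<mu>"
    using assms by simp
  finally have "\<rho> * sqrt l \<le> sqrt \<mu>" .
  moreover have "\<rho> * sqrt \<mu> \<le> sqrt \<mu>"
    using assms by (simp add: mult_left_le_one_le)
  ultimately have "sqrt l - sqrt \<mu> \<le> (1 - \<rho>) * (sqrt l + sqrt \<mu>)"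
    by (simp add: algebra_simps)
  then show "\<theta> \<le> 1 - \<rho>"
    using pos by (simp add: \<theta>_def pos_divide_le_eq)
qed

text \<open>The slack between the two sides is \<open>(1 - \<rho>) \<parallel>\<rho> Y + (1 - \<rho> - \<theta>) d\<parallel>\<^sup>2 + 2 \<theta> (1 - \<rho>) (1 - \<rho> - \<theta>) \<parallel>d\<parallel>\<^sup>2\<close>.\<close>

lemma energy_quadratic_form_le:
  fixes Y d :: "'a::real_inner" and \<rho> \<theta> :: real
  assumes "0 \<le> \<theta>" "\<theta> \<le> 1 - \<rho>"
  shows "(norm (\<rho> *\<^sub>R Y + \<theta> *\<^sub>R d))\<^sup>2 - (1 - \<rho>) * \<rho> * \<theta>\<^sup>2 * (norm d)\<^sup>2 - \<rho>\<^sup>2 * (norm (Y + \<theta> *\<^sub>R d))\<^sup>2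
    \<le> (1 - \<rho>) * (norm (\<rho> *\<^sub>R Y + (1 - \<rho>) *\<^sub>R d))\<^sup>2" (is "?l \<le> ?r")
proof -
  have "?r - ?l = (1 - \<rho>) * (norm (\<rho> *\<^sub>R Y + (1 - \<rho> - \<theta>) *\<^sub>R d))\<^sup>2
      + 2 * \<theta> * (1 - \<rho>) * (1 - \<rho> - \<theta>) * (norm d)\<^sup>2"
    unfolding power2_norm_eq_inner inner_add_left inner_add_right inner_scaleR_left inner_scaleR_right
      inner_commute[of d Y]
    by algebra
  also have "\<dots> \<ge> 0"
    using assms by simp
  finally show ?thesis by simp
qed

text \<open>The displacement \<open>d\<close> is an argument of its own because no previous iterate
  exists at the start, where it is taken to be 0.\<close>

definition energy :: "('a::euclidean_space \<Rightarrow> real) \<Rightarrow> 'a \<Rightarrow> real \<Rightarrow> real \<Rightarrow> 'a \<Rightarrow> 'a \<Rightarrow> real" where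
  "energy f xstar \<rho> l y d =
    (f y - f xstar) / l + (norm (\<rho> *\<^sub>R (y - xstar) + (1 - \<rho>) *\<^sub>R d))\<^sup>2 / 2"

text \<open>The gradient terms of the function part cancel exactly against those of the squared
  norm. What remains is half of \<open>energy_quadratic_form_le\<close>.\<close>

lemma energy_gd_step_le:
  assumes f: "f \<in> smooth_strongly_convex L m" and l: "l > 0" and \<rho>: "0 \<le> \<rho>" "\<rho> * l \<le> m"
    and \<theta>: "0 \<le> \<theta>" "\<theta> \<le> 1 - \<rho>" and x: "x = y + \<theta> *\<^sub>R d"
    and dec: "f (gd_step f l x) \<le> f x - 1 / (2 * l) * (norm (grad f x))\<^sup>2"
  shows "energy f xstar \<rho> l (gd_step f l x) (gd_step f l x - y) \<le> (1 - \<rho>) * energy f xstar \<rho> l y d"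
proof -
  define Y where "Y = y - xstar"
  define G where "G = grad f x /\<^sub>R l"
  have g: "grad f x = l *\<^sub>R G" using l by (simp add: G_def)
  \<comment> \<open>Strong convexity scaled by \<open>1 / l\<close>, with the modulus
    \<open>m\<close> weakened to \<open>\<rho> * l\<close>.\<close>
  have convex: "(f x - f z) / l \<le> G \<bullet> (x - z) - \<rho> / 2 * (norm (x - z))\<^sup>2" for z
  proof -
    have "\<rho> * l / 2 * (norm (z - x))\<^sup>2 \<le> m / 2 * (norm (z - x))\<^sup>2"
      using \<rho> by (intro mult_right_mono) auto
    then have "f x - f z \<le> l * (G \<bullet> (x - z)) - \<rho> * l / 2 * (norm (x - z))\<^sup>2"
      using smooth_strongly_convexD(3)[OF f, where x = x and y = z]
      by (simp add: g norm_minus_commute inner_diff_right algebra_simps)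
    then show ?thesis using l by (simp add: field_simps)
  qed
  have cy: "(f x - f y) / l \<le> \<theta> * (G \<bullet> d) - \<rho> / 2 * (\<theta>\<^sup>2 * (norm d)\<^sup>2)"
    using convex[of y] by (simp add: x power_mult_distrib)
  have cs: "(f x - f xstar) / l \<le> G \<bullet> (Y + \<theta> *\<^sub>R d) - \<rho> / 2 * (norm (Y + \<theta> *\<^sub>R d))\<^sup>2"
    using convex[of xstar] by (simp add: x Y_def algebra_simps)
  have step: "gd_step f l x = y + \<theta> *\<^sub>R d - G"
    using l by (simp add: gd_step_def x G_def divide_inverse_commute)
  have "f (gd_step f l x) - f x \<le> - (l * (norm G)\<^sup>2 / 2)"
    using dec l by (simp add: g power_mult_distrib field_simps power2_eq_square)
  then have "(f (gd_step f l x) - f x) / l \<le> - ((norm G)\<^sup>2 / 2)"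
    using l by (simp add: field_simps)
  \<comment> \<open>The gap at \<open>x\<close> is averaged over comparisons with \<open>y\<close>
    and \<open>xstar\<close>, with weights \<open>1 - \<rho>\<close> and
    \<open>\<rho>\<close>.\<close>
  moreover have "(f (gd_step f l x) - f xstar) / l = (f (gd_step f l x) - f x) / l
      + (1 - \<rho>) * ((f x - f y) / l) + \<rho> * ((f x - f xstar) / l) + (1 - \<rho>) * ((f y - f xstar) / l)"
    using l by (simp add: field_simps)
  moreover note mult_left_mono[OF cy, of "1 - \<rho>"] mult_left_mono[OF cs, of \<rho>]
  ultimately have F: "(f (gd_step f l x) - f xstar) / l \<le> - ((norm G)\<^sup>2 / 2)
      + (1 - \<rho>) * (\<theta> * (G \<bullet> d) - \<rho> / 2 * (\<theta>\<^sup>2 * (norm d)\<^sup>2))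
      + \<rho> * (G \<bullet> Y + \<theta> * (G \<bullet> d) - \<rho> / 2 * (norm (Y + \<theta> *\<^sub>R d))\<^sup>2)
      + (1 - \<rho>) * ((f y - f xstar) / l)"
    using \<rho>(1) \<theta> unfolding inner_add_right inner_scaleR_right by linarith
  \<comment> \<open>The weights of the new point add up to 1, so \<open>G\<close> enters with
    coefficient exactly -1.\<close>
  have u: "\<rho> *\<^sub>R (gd_step f l x - xstar) + (1 - \<rho>) *\<^sub>R (gd_step f l x - y)
      = \<rho> *\<^sub>R Y + \<theta> *\<^sub>R d - G"
    by (simp add: step Y_def algebra_simps)
  have N: "(norm (\<rho> *\<^sub>R (gd_step f l x - xstar) + (1 - \<rho>) *\<^sub>R (gd_step f l x - y)))\<^sup>2
      = (norm (\<rho> *\<^sub>R Y + \<theta> *\<^sub>R d))\<^sup>2 - 2 * (\<rho> * (G \<bullet> Y) + \<theta> * (G \<bullet> d)) + (norm G)\<^sup>2"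
    unfolding u by (simp add: power2_norm_eq_inner inner_diff_left inner_diff_right inner_add_left inner_add_right
        inner_commute algebra_simps)
  show ?thesis
    using F N energy_quadratic_form_le[OF \<theta>, of Y d]
    unfolding energy_def Y_def[symmetric] power2_eq_square by argo
qed

lemma energy_antimono:
  assumes "f xstar \<le> f y" "0 < l" "l \<le> l'"
  shows "energy f xstar \<rho> l' y d \<le> energy f xstar \<rho> l y d"
  using assms by (simp add: energy_def divide_left_mono)

section \<open>Invariants along the iterations\<close>

text \<open>Only the lower bound on \<open>\<mu>'\<close> is conditional on
  \<open>x' \<noteq> x\<close>, since it rests on the quotient \<open>c\<close>. The energy bound
  thus also covers a final step whose new \<open>x'\<close> equals \<open>x\<close>.\<close>

lemma nag_step_energy:
  assumes f: "f \<in> smooth_strongly_convex L m" and min: "is_arg_min f (\<lambda>_. True) xstar"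
    and \<gamma>: "1 < \<gamma>" "\<gamma> \<le> 2" and \<gamma>L: "1 < \<gamma>L" "\<gamma>L \<le> 2"
    and K: "2 * L \<le> K" "2 * m \<le> K" and l: "0 < l" "l \<le> K" and \<mu>: "m / 2 \<le> \<mu>" "\<mu> \<le> l"
    and \<theta>: "0 \<le> \<theta>" "\<theta> \<le> 1 - m / K" and x: "x = y + \<theta> *\<^sub>R d"
    and step: "nag_step f \<gamma> \<gamma>L (Nag_State x y l \<mu>) = Nag_State x' y' l' \<mu>'"
  obtains \<theta>' where "0 \<le> \<theta>'" "\<theta>' \<le> 1 - m / K" "x' = y' + \<theta>' *\<^sub>R (y' - y)"
    and "l \<le> l'" "l' \<le> K" "\<mu>' \<le> \<mu>" "x' \<noteq> x \<Longrightarrow> m / 2 \<le> \<mu>'"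
    and "energy f xstar (m / K) l' y' (y' - y) \<le> (1 - m / K) * energy f xstar (m / K) l y d"
proof -
  have m: "m > 0" and "K > 0"
    using smooth_strongly_convexD(2)[OF f] K by auto
  define c where "c = norm (grad f x' - grad f x) / norm (x' - x)"
  have l': "l' = backtrack f \<gamma>L x l" and y': "y' = gd_step f l' x"
    and x': "x' = y' + ((sqrt l' - sqrt \<mu>) / (sqrt l' + sqrt \<mu>)) *\<^sub>R (y' - y)"
    and \<mu>': "\<mu>' = (if c < \<mu> then min (\<mu> / \<gamma>) c else \<mu>)"
    using step by (auto simp: Let_def c_def)
  have "l \<le> l'" and "l' \<le> max l (\<gamma>L * L)"
    and dec: "f (gd_step f l' x) \<le> f x - 1 / (2 * l') * (norm (grad f x))\<^sup>2"
    using backtrack_bounds[OF f \<gamma>L(1) l(1)] by (simp_all add: l')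
  have "\<gamma>L * L \<le> K"
    using mult_right_mono[OF \<gamma>L(2), of L] smooth_strongly_convexD(1)[OF f] K by linarith
  with \<open>l' \<le> max l (\<gamma>L * L)\<close> l have "l' \<le> K" by auto
  have "m / K \<le> 1 / 2"
    using K \<open>K > 0\<close> by simp
  \<comment> \<open>With \<open>\<rho> = m / K\<close>, the chain is
    \<open>\<rho>\<^sup>2 * l' \<le> \<rho> * m \<le> m / 2 \<le> \<mu>\<close>, the hypothesis of
    \<open>momentum_bounds\<close>.\<close>
  have "(m / K)\<^sup>2 * l' \<le> (m / K)\<^sup>2 * K"
    using \<open>l' \<le> K\<close> by (intro mult_left_mono) auto
  also have "\<dots> = m / K * m"
    using \<open>K > 0\<close> by (simp add: power2_eq_square)
  also have "\<dots> \<le> 1 / 2 * m"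
    using \<open>m / K \<le> 1 / 2\<close> m by (intro mult_right_mono) auto
  also have "\<dots> \<le> \<mu>"
    using \<mu> by simp
  finally have "(m / K)\<^sup>2 * l' \<le> \<mu>" .
  then have \<theta>': "0 \<le> (sqrt l' - sqrt \<mu>) / (sqrt l' + sqrt \<mu>)"
      "(sqrt l' - sqrt \<mu>) / (sqrt l' + sqrt \<mu>) \<le> 1 - m / K"
    using momentum_bounds[of l' \<mu> "m / K"] \<open>l \<le> l'\<close> l \<mu> m \<open>K > 0\<close> \<open>m / K \<le> 1 / 2\<close> by auto
  have "m / K * l' \<le> m / K * K"
    using \<open>l' \<le> K\<close> \<open>K > 0\<close> m by (intro mult_left_mono) auto
  then have "m / K * l' \<le> m"
    using \<open>K > 0\<close> by simp
  then have "energy f xstar (m / K) l' y' (y' - y) \<le> (1 - m / K) * energy f xstar (m / K) l' y d"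
    unfolding y' using \<open>l \<le> l'\<close> l m \<open>K > 0\<close> \<theta> x dec by (intro energy_gd_step_le[OF f]) auto
  also have "\<dots> \<le> (1 - m / K) * energy f xstar (m / K) l y d"
    using \<open>m / K \<le> 1 / 2\<close> min l \<open>l \<le> l'\<close>
    by (intro mult_left_mono energy_antimono) (auto simp: is_arg_min_linorder)
  finally have en: "energy f xstar (m / K) l' y' (y' - y) \<le> (1 - m / K) * energy f xstar (m / K) l y d" .
  have "\<mu> / \<gamma> \<le> \<mu>" "\<mu> / 2 \<le> \<mu> / \<gamma>"
    using \<gamma> \<mu> m by (auto simp: field_simps)
  then have "\<mu>' \<le> \<mu>"
    by (auto simp: \<mu>')
  \<comment> \<open>The estimate is lowered only when it exceeds \<open>c \<ge> m\<close>, and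
    division by \<open>\<gamma> \<le> 2\<close> then leaves at least \<open>m / 2\<close>.\<close>
  have "m / 2 \<le> \<mu>'" if "x' \<noteq> x"
  proof -
    have "m \<le> c"
      using norm_grad_diff_ge[OF f, of x' x] that by (simp add: c_def field_simps)
    then show ?thesis
      using \<open>\<mu> / 2 \<le> \<mu> / \<gamma>\<close> \<mu> m by (auto simp: \<mu>')
  qed
  with that[OF \<theta>' x' \<open>l \<le> l'\<close> \<open>l' \<le> K\<close> \<open>\<mu>' \<le> \<mu>\<close> _ en] show ?thesis .
qed

lemma nag_free_energy:
  assumes f: "f \<in> smooth_strongly_convex L m" and min: "is_arg_min f (\<lambda>_. True) xstar"
    and \<gamma>: "1 < \<gamma>" "\<gamma> \<le> 2" and \<gamma>L: "1 < \<gamma>L" "\<gamma>L \<le> 2"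
    and K: "2 * L \<le> K" "2 * m \<le> K" and L0: "m \<le> L0" "L0 \<le> K"
    and ne: "\<And>s. s < t \<Longrightarrow> nag_x (nag_free f L0 \<gamma> \<gamma>L x0 (Suc s)) \<noteq> nag_x (nag_free f L0 \<gamma> \<gamma>L x0 s)"
  obtains x y l \<mu> \<theta> d where "nag_free f L0 \<gamma> \<gamma>L x0 t = Nag_State x y l \<mu>"
    and "0 \<le> \<theta>" "\<theta> \<le> 1 - m / K" "x = y + \<theta> *\<^sub>R d"
    and "0 < l" "l \<le> K" "m / 2 \<le> \<mu>" "\<mu> \<le> l"
    and "energy f xstar (m / K) l y d \<le> (1 - m / K) ^ t * energy f xstar (m / K) L0 x0 0"
  using ne
proof (induction t arbitrary: thesis)
  case 0
  have "m > 0" "m / K \<le> 1"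
    using smooth_strongly_convexD(2)[OF f] K by (auto simp: pos_divide_le_eq)
  then show ?case
    \<comment> \<open>Both iterates start at \<open>x0\<close>, so \<open>\<theta> = 0\<close> and
      \<open>d = 0\<close> represent the initial state.\<close>
    using L0 by (intro 0(1)[of x0 x0 L0 L0 0 0]) (auto simp: nag_free_def)
next
  case (Suc t)
  obtain x y l \<mu> \<theta> d where S: "nag_free f L0 \<gamma> \<gamma>L x0 t = Nag_State x y l \<mu>"
    and \<theta>: "0 \<le> \<theta>" "\<theta> \<le> 1 - m / K" "x = y + \<theta> *\<^sub>R d"
    and l: "0 < l" "l \<le> K" and \<mu>: "m / 2 \<le> \<mu>" "\<mu> \<le> l"
    and en: "energy f xstar (m / K) l y d \<le> (1 - m / K) ^ t * energy f xstar (m / K) L0 x0 0"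
    using Suc.IH Suc.prems(2) less_SucI by metis
  obtain x' y' l' \<mu>' where step: "nag_step f \<gamma> \<gamma>L (Nag_State x y l \<mu>) = Nag_State x' y' l' \<mu>'"
    by (metis nag_state.exhaust)
  then have S': "nag_free f L0 \<gamma> \<gamma>L x0 (Suc t) = Nag_State x' y' l' \<mu>'"
    using S by (simp add: nag_free_def)
  have "x' \<noteq> x"
    using Suc.prems(2)[of t] by (simp add: S S')
  obtain \<theta>' where \<theta>': "0 \<le> \<theta>'" "\<theta>' \<le> 1 - m / K" "x' = y' + \<theta>' *\<^sub>R (y' - y)"
    and l': "l \<le> l'" "l' \<le> K" and \<mu>': "\<mu>' \<le> \<mu>" "m / 2 \<le> \<mu>'"
    and en': "energy f xstar (m / K) l' y' (y' - y) \<le> (1 - m / K) * energy f xstar (m / K) l y d"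
    using nag_step_energy[OF f min \<gamma> \<gamma>L K l \<mu> \<theta> step] \<open>x' \<noteq> x\<close> by metis
  note en'
  also have "(1 - m / K) * energy f xstar (m / K) l y d
      \<le> (1 - m / K) * ((1 - m / K) ^ t * energy f xstar (m / K) L0 x0 0)"
    using en \<theta> by (intro mult_left_mono) auto
  finally show ?case
    using Suc.prems(1)[OF S' \<theta>'] l l' \<mu> \<mu>' by simp
qed

theorem theorem3:
  fixes f :: "'a::euclidean_space \<Rightarrow> real"
    and L m L0 \<gamma> \<gamma>L \<kappa>bar :: real
    and x0 xstar :: 'a
    and x y :: "nat \<Rightarrow> 'a"
    and t :: nat
  assumes "f \<in> smooth_strongly_convex L m"
    and "is_arg_min f (\<lambda>_. True) xstar"
    and "\<And>z. is_arg_min f (\<lambda>_. True) z \<Longrightarrow> z = xstar"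
    and "L / m \<ge> 2"
    and "L0 \<ge> m"
    and "1 < \<gamma>" and "\<gamma> \<le> 2"
    and "1 < \<gamma>L" and "\<gamma>L \<le> 2"
    and "\<And>s. x s = nag_x (nag_free f L0 \<gamma> \<gamma>L x0 s)"
    and "\<And>s. y s = nag_y (nag_free f L0 \<gamma> \<gamma>L x0 s)"
    and "\<And>s. s < t \<Longrightarrow> x (Suc s) \<noteq> x s"
    and "\<kappa>bar = max L0 (2 * L) / m"
  shows "f (y (Suc t)) - f xstar
      \<le> (1 - 1 / \<kappa>bar) ^ t * (8 * max L0 L * \<kappa>bar ^ 3 * (norm (x0 - xstar))\<^sup>2)"
proof -
  note f = assms(1) and min = assms(2) and x = assms(10) and y = assms(11) and \<kappa>bar = assms(13)
  define K where "K = max L0 (2 * L)"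
  have pos: "L > 0" "m > 0" and m: "2 * m \<le> L"
    using smooth_strongly_convexD(1,2)[OF f] assms(4) by (auto simp: field_simps)
  have K: "2 * L \<le> K" "2 * m \<le> K" "L0 \<le> K" and "K > 0"
    using pos m by (auto simp: K_def)
  have \<rho>: "1 / \<kappa>bar = m / K" and \<kappa>K: "\<kappa>bar * m = K" and "\<kappa>bar \<ge> 1"
    using pos K by (auto simp: \<kappa>bar K_def[symmetric])
  let ?E = "energy f xstar (m / K)" and ?N = "(norm (x0 - xstar))\<^sup>2"
  obtain xt yt l \<mu> \<theta> d where S: "nag_free f L0 \<gamma> \<gamma>L x0 t = Nag_State xt yt l \<mu>"
    and \<theta>: "0 \<le> \<theta>" "\<theta> \<le> 1 - m / K" "xt = yt + \<theta> *\<^sub>R d"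
    and l: "0 < l" "l \<le> K" and \<mu>: "m / 2 \<le> \<mu>" "\<mu> \<le> l"
    and en: "?E l yt d \<le> (1 - m / K) ^ t * ?E L0 x0 0"
    by (rule nag_free_energy[OF f min assms(6-9) K(1,2) assms(5) K(3), of t x0])
      (use assms(12) x in auto)
  obtain x' y' l' \<mu>' where step: "nag_step f \<gamma> \<gamma>L (Nag_State xt yt l \<mu>) = Nag_State x' y' l' \<mu>'"
    by (metis nag_state.exhaust)
  then have yS: "y (Suc t) = y'"
    using S by (simp add: y nag_free_def)
  obtain l': "l \<le> l'" "l' \<le> K" and en': "?E l' y' (y' - yt) \<le> (1 - m / K) * ?E l yt d"
    by (rule nag_step_energy[OF f min assms(6-9) K(1,2) l \<mu> \<theta> step])
  have "f xstar \<le> f z" for z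
    using min by (simp add: is_arg_min_linorder)
  then have E_nonneg: "0 \<le> ?E l yt d"
    using l by (simp add: energy_def)
  \<comment> \<open>The gradient vanishes at \<open>xstar\<close> and \<open>L0 \<ge> m\<close>, so
    the function part is at most half of the bound; so is the norm part, by
    \<open>m / K \<le> 1 \<le> L / m\<close>.\<close>
  have E0: "?E L0 x0 0 \<le> (L / m) * ?N"
  proof -
    have "f x0 - f xstar \<le> L / 2 * ?N"
      using smooth_strongly_convexD(4)[OF f, where x = xstar and y = x0]
      by (simp add: grad_minimizer_eq_0[OF f min])
    then have "(f x0 - f xstar) / L0 \<le> (L / 2 * ?N) / m"
      using assms(5) pos by (intro frac_le) auto
    then have "(f x0 - f xstar) / L0 \<le> (L / m * ?N) / 2"
      by simp
    moreover have "(norm ((m / K) *\<^sub>R (x0 - xstar)))\<^sup>2 \<le> 1 * ?N"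
      unfolding norm_scaleR power_mult_distrib
      using pos K by (intro mult_right_mono) (auto simp: power_le_one)
    moreover have "1 * ?N \<le> L / m * ?N"
      using assms(4) by (intro mult_right_mono) auto
    ultimately have "(f x0 - f xstar) / L0 + (norm ((m / K) *\<^sub>R (x0 - xstar)))\<^sup>2 / 2 \<le> L / m * ?N"
      by argo
    then show ?thesis
      by (simp add: energy_def)
  qed
  have "(f y' - f xstar) / l' \<le> ?E l' y' (y' - yt)"
    by (simp add: energy_def)
  \<comment> \<open>The contraction factor of the last step is bounded by 1, hence the exponent
    \<open>t\<close> for the iterate with index \<open>Suc t\<close>.\<close>
  also have "\<dots> \<le> 1 * ?E l yt d"
    using en' mult_right_mono[OF _ E_nonneg, of "1 - m / K" 1] pos \<open>K > 0\<close> by auto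
  also have "\<dots> \<le> (1 - m / K) ^ t * ?E L0 x0 0"
    using en by simp
  also have "\<dots> \<le> (1 - m / K) ^ t * (L / m * ?N)"
    using E0 \<theta> by (intro mult_left_mono) auto
  finally have "f y' - f xstar \<le> l' * ((1 - m / K) ^ t * (L / m * ?N))"
    using l l' by (simp add: pos_divide_le_eq mult.commute)
  also have "\<dots> \<le> K * ((1 - m / K) ^ t * (L / m * ?N))"
    using l' \<theta> pos by (intro mult_right_mono) auto
  also have "\<dots> = (1 - m / K) ^ t * (L * \<kappa>bar * ?N)"
    using pos by (simp flip: \<kappa>K)
  \<comment> \<open>The energy argument yields the constant \<open>L * \<kappa>bar\<close>, which is
    relaxed to the stated one.\<close>
  also have "\<dots> \<le> (1 - m / K) ^ t * (8 * max L0 L * \<kappa>bar ^ 3 * ?N)"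
  proof -
    have "\<kappa>bar \<le> \<kappa>bar ^ 3"
      using \<open>\<kappa>bar \<ge> 1\<close> by (simp add: self_le_power)
    then have "L * \<kappa>bar \<le> 8 * max L0 L * \<kappa>bar ^ 3"
      using \<open>\<kappa>bar \<ge> 1\<close> pos by (intro mult_mono) auto
    then show ?thesis
      using \<theta> by (intro mult_left_mono mult_right_mono) auto
  qed
  finally show ?thesis
    by (simp add: yS \<rho>)
qed

end
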